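(* Let $N\ge3$. For every tone $k$, user $n$, distinct reference users $q,t\in\mathcal N\setminus\{n\}$ and approximation point $\tilde{\mathbf s}_k\in\mathcal S_k$, the approximation $f_k^{\mathrm{IASB10}}$ is tighter than each of $f_k^{\mathrm{IASB1}}$, $f_k^{\mathrm{IASB4}}$ (with reference user $q$), $f_k^{\mathrm{IASB5}}$ (with reference users $q,t$), $f_k^{\mathrm{CADSB}}$ and $f_k^{\mathrm{SCALE}}$, as functions of $s_k^n\in\mathcal S_k^n$.
   Context: Users $\mathcal N=\{1,\dots,N\}$. On tone $k$, $\mathbf s_k=(s_k^1,\dots,s_k^N)$ are the transmit powers, $\mathcal S_k^n=[0,s_k^{n,\mathrm{mask}}]$ with $s_k^{n,\mathrm{mask}}>0$, $\mathcal S_k=\prod_n\mathcal S_k^n$. Constants: weights $w_n\ge0$, gains $a_k^{n,m}\ge0$, noise powers $z_k^n>0$. Put $\mathrm{int}_k^n=\sum_{m\ne n}a_k^{n,m}s_k^m+z_k^n$, $\mathrm{rec}_k^n=s_k^n+\mathrm{int}_k^n$, and $f_k(\mathbf s_k)=-\sum_{m\in\mathcal N}w_m\log(1+s_k^m/\mathrm{int}_k^m)$. Constants depending only on $\tilde{\mathbf s}_k$, for each user $p$: $\alpha_k^p=\tilde s_k^p/\mathrm{rec}_k^p|_{\mathbf s_k=\tilde{\mathbf s}_k}$ and $c_k^p$ is such that $-w_p\log(1+s_k^p/\mathrm{int}_k^p)\le-w_p\alpha_k^p\log(s_k^p/\mathrm{int}_k^p)-c_k^p$ holds with equality at $\mathbf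 s_k=\tilde{\mathbf s}_k$, i.e. $c_k^p=w_p[\log(1+\tilde\rho^p)-\alpha_k^p\log\tilde\rho^p]$ with $\tilde\rho^p=s_k^p/\mathrm{int}_k^p|_{\mathbf s_k=\tilde{\mathbf s}_k}$. If $\tilde s_k^p=0$ (so $\alpha_k^p=0$), terms $\alpha_k^p\log(\cdot)$ are read as $0$; if $w_p\alpha_k^p>0$, the expression $-w_p\alpha_k^p\log(s_k^p/\mathrm{int}_k^p)$ is read as $+\infty$ at $s_k^p=0$. Fix user $n$; all functions below are functions of the single variable $s_k^n\in\mathcal S_k^n$, with $s_k^m=\tilde s_k^m$ for all $m\ne n$. Given a decomposition $f_k=f_k^1+f_k^2$, the associated approximation is $f_k^1+\mathrm{LIN}(f_k^2)$, where $\mathrm{LIN}(f_k^2)$ is the first-order (affine) Taylor approximation of $f_k^2$ at $s_k^n=\tilde s_k^n$. In each case below $f_k^1$ is given and $f_k^2=f_k-f_k^1$. - $f_k^{\mathrm{CADSB}}$: $f_k^1=-\sum_{m\in\mathcal N}w_m\log(\mathrm{rec}_k^m)$. - $f_k^{\mathrm{IASB1}}$: $f_k^1=-w_n\log(1+s_k^n/\mathrm{int}_k^n)$. - $f_k^{\mathrm{IASB4}}$: $f_k^1=-w_n\log(1+s_k^n/\mathrm{int}_k^n)-w_q\alpha_k^q\log(s_k^q/\mathrm{int}_k^q)-c_k^q$. - $f_k^{\mathrm{IASB5}}$: $f_k^1=-w_n\log(1+s_k^n/\mathrm{int}_k^n)-\sum_{p\in\{q,t\}}[w_p\alpha_k^p\log(s_k^p/\mathrm{int}_k^p)+c_k^p]$.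 - $f_k^{\mathrm{IASB10}}$: $f_k^1=-w_n\log(1+s_k^n/\mathrm{int}_k^n)-\sum_{m\in\mathcal N\setminus\{n\}}[w_m\alpha_k^m\log(s_k^m/\mathrm{int}_k^m)+c_k^m]$. The SCALE approximation is the function $$f_k^{\mathrm{SCALE}}=-\sum_{m\in\mathcal N}\left[w_m\alpha_k^m\log\left(\frac{s_k^m}{\mathrm{int}_k^m}\right)+c_k^m\right].$$ An approximation $A$ is "tighter" than $B$ if its approximation error is no larger along the dimension $s_k^n$: $f_k(s_k^n)\le A(s_k^n)\le B(s_k^n)$ for all $s_k^n\in\mathcal S_k^n$. *)

theory Defs
  imports "HOL-Analysis.Analysis"
begin

record 'k dsm =
  num_users :: nat
  weight :: "nat \<Rightarrow> real"
  gain :: "'k \<Rightarrow> nat \<Rightarrow> nat \<Rightarrow> real"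
  noise :: "'k \<Rightarrow> nat \<Rightarrow> real"
  mask :: "'k \<Rightarrow> nat \<Rightarrow> real"

definition users :: "'k dsm \<Rightarrow> nat set" where
  "users P = {1..num_users P}"

definition valid_dsm :: "'k dsm \<Rightarrow> bool" where
  "valid_dsm P \<longleftrightarrow>
     (\<forall>n\<in>users P. 0 \<le> weight P n) \<and>
     (\<forall>k. \<forall>n\<in>users P. \<forall>m\<in>users P. 0 \<le> gain P k n m) \<and>
     (\<forall>k. \<forall>n\<in>users P. 0 < noise P k n) \<and>
     (\<forall>k. \<forall>n\<in>users P. 0 < mask P k n)"

definition user_powers :: "'k dsm \<Rightarrow> 'k \<Rightarrow> nat \<Rightarrow> real set" where
  "user_powers P k n = {0..mask P k n}"

definition powers :: "'k dsm \<Rightarrow> 'k \<Rightarrow> (nat \<Rightarrow> real) set" where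
  "powers P k = Pi\<^sub>E (users P) (user_powers P k)"

definition interf :: "'k dsm \<Rightarrow> 'k \<Rightarrow> (nat \<Rightarrow> real) \<Rightarrow> nat \<Rightarrow> real" where
  "interf P k s n = (\<Sum>m\<in>users P - {n}. gain P k n m * s m) + noise P k n"

definition recv :: "'k dsm \<Rightarrow> 'k \<Rightarrow> (nat \<Rightarrow> real) \<Rightarrow> nat \<Rightarrow> real" where
  "recv P k s n = s n + interf P k s n"

definition obj :: "'k dsm \<Rightarrow> 'k \<Rightarrow> (nat \<Rightarrow> real) \<Rightarrow> real" where
  "obj P k s = - (\<Sum>m\<in>users P. weight P m * ln (1 + s m / interf P k s m))"

text \<open>In what follows \<open>st\<close> is the approximation point. The convention that
  \<open>\<alpha> log(\<cdot>)\<close> is \<open>0\<close> when \<open>\<alpha> = 0\<close> holds automatically, since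
  \<open>ln\<close> is a total function.\<close>

definition alpha :: "'k dsm \<Rightarrow> 'k \<Rightarrow> (nat \<Rightarrow> real) \<Rightarrow> nat \<Rightarrow> real" where
  "alpha P k st p = st p / recv P k st p"

definition cconst :: "'k dsm \<Rightarrow> 'k \<Rightarrow> (nat \<Rightarrow> real) \<Rightarrow> nat \<Rightarrow> real" where
  "cconst P k st p = weight P p *
     (ln (1 + st p / interf P k st p) - alpha P k st p * ln (st p / interf P k st p))"

text \<open>The term \<open>w\<^sub>p \<alpha>\<^sup>p log(s\<^sup>p / int\<^sup>p) + c\<^sup>p\<close> at power vector \<open>s\<close>;
  it has its intended meaning unless \<open>w\<^sub>p \<alpha>\<^sup>p > 0\<close> and \<open>s\<^sup>p = 0\<close>.\<close>

definition log_term :: "'k dsm \<Rightarrow> 'k \<Rightarrow> (nat \<Rightarrow> real) \<Rightarrow> nat \<Rightarrow> (nat \<Rightarrow> real) \<Rightarrow> real" where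
  "log_term P k st p s =
     weight P p * alpha P k st p * ln (s p / interf P k s p) + cconst P k st p"

text \<open>The negated term with the value \<open>\<infinity>\<close> in the exceptional case.\<close>

definition neg_log_term ::
    "'k dsm \<Rightarrow> 'k \<Rightarrow> (nat \<Rightarrow> real) \<Rightarrow> nat \<Rightarrow> (nat \<Rightarrow> real) \<Rightarrow> ereal" where
  "neg_log_term P k st p s =
     (if weight P p * alpha P k st p > 0 \<and> s p = 0 then \<infinity>
      else ereal (- log_term P k st p s))"

text \<open>When only user \<open>n\<close>'s power varies, the exceptional case can occur for \<open>p = n\<close> only,
  so the decompositions below, which use \<open>p \<noteq> n\<close>, are real-valued.\<close>

lemma neg_log_term_other_user:
  assumes "p \<noteq> n"
  shows "neg_log_term P k st p (st(n := x)) = ereal (- log_term P k st p (st(n := x)))"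
  using assms by (auto simp: neg_log_term_def alpha_def)

text \<open>The functions \<open>f\<^sup>2\<close> linearized below are differentiable in a two-sided neighbourhood of
  every point of \<open>user_powers P k n\<close>, end points included (noise powers are positive), so \<open>deriv\<close>
  also agrees with the one-sided derivative at the end points.\<close>

definition LIN :: "(real \<Rightarrow> real) \<Rightarrow> real \<Rightarrow> real \<Rightarrow> real" where
  "LIN g x0 x = g x0 + deriv g x0 * (x - x0)"

definition approx_of ::
    "'k dsm \<Rightarrow> 'k \<Rightarrow> nat \<Rightarrow> (nat \<Rightarrow> real) \<Rightarrow> ((nat \<Rightarrow> real) \<Rightarrow> real) \<Rightarrow> real \<Rightarrow> real" where
  "approx_of P k n st f1 x =
     f1 (st(n := x)) + LIN (\<lambda>y. obj P k (st(n := y)) - f1 (st(n := y))) (st n) x"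

definition CADSB_f1 :: "'k dsm \<Rightarrow> 'k \<Rightarrow> (nat \<Rightarrow> real) \<Rightarrow> real" where
  "CADSB_f1 P k s = - (\<Sum>m\<in>users P. weight P m * ln (recv P k s m))"

text \<open>The part \<open>f\<^sup>1\<close> of an IASB decomposition, with set \<open>R\<close> of reference users.\<close>

definition IASB_f1 ::
    "'k dsm \<Rightarrow> 'k \<Rightarrow> nat \<Rightarrow> (nat \<Rightarrow> real) \<Rightarrow> nat set \<Rightarrow> (nat \<Rightarrow> real) \<Rightarrow> real" where
  "IASB_f1 P k n st R s =
     - weight P n * ln (1 + s n / interf P k s n) - (\<Sum>p\<in>R. log_term P k st p s)"

definition f_CADSB :: "'k dsm \<Rightarrow> 'k \<Rightarrow> nat \<Rightarrow> (nat \<Rightarrow> real) \<Rightarrow> real \<Rightarrow> real" where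
  "f_CADSB P k n st = approx_of P k n st (CADSB_f1 P k)"

definition f_IASB1 :: "'k dsm \<Rightarrow> 'k \<Rightarrow> nat \<Rightarrow> (nat \<Rightarrow> real) \<Rightarrow> real \<Rightarrow> real" where
  "f_IASB1 P k n st = approx_of P k n st (IASB_f1 P k n st {})"

definition f_IASB4 :: "'k dsm \<Rightarrow> 'k \<Rightarrow> nat \<Rightarrow> nat \<Rightarrow> (nat \<Rightarrow> real) \<Rightarrow> real \<Rightarrow> real" where
  "f_IASB4 P k n q st = approx_of P k n st (IASB_f1 P k n st {q})"

definition f_IASB5 :: "'k dsm \<Rightarrow> 'k \<Rightarrow> nat \<Rightarrow> nat \<Rightarrow> nat \<Rightarrow> (nat \<Rightarrow> real) \<Rightarrow> real \<Rightarrow> real" where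
  "f_IASB5 P k n q t st = approx_of P k n st (IASB_f1 P k n st {q, t})"

definition f_IASB10 :: "'k dsm \<Rightarrow> 'k \<Rightarrow> nat \<Rightarrow> (nat \<Rightarrow> real) \<Rightarrow> real \<Rightarrow> real" where
  "f_IASB10 P k n st = approx_of P k n st (IASB_f1 P k n st (users P - {n}))"

definition f_SCALE :: "'k dsm \<Rightarrow> 'k \<Rightarrow> nat \<Rightarrow> (nat \<Rightarrow> real) \<Rightarrow> real \<Rightarrow> ereal" where
  "f_SCALE P k n st x = (\<Sum>m\<in>users P. neg_log_term P k st m (st(n := x)))"

definition tighter ::
    "'k dsm \<Rightarrow> 'k \<Rightarrow> nat \<Rightarrow> (nat \<Rightarrow> real) \<Rightarrow> (real \<Rightarrow> ereal) \<Rightarrow> (real \<Rightarrow> ereal) \<Rightarrow> bool" where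
  "tighter P k n st A B \<longleftrightarrow>
     (\<forall>x\<in>user_powers P k n. ereal (obj P k (st(n := x))) \<le> A x \<and> A x \<le> B x)"

end

(* Only user n's power x varies, so int_n is constant and int_m, m \<noteq> n, is affine in x.
   IASB10 replaces each term of f with m \<noteq> n by its bound -(w_m \<alpha>_m log(s_m / int_m) + c_m). This
   bound lies above the term and touches it at the approximation point, so both have the same tangent
   there, and being concave in x it lies below that tangent, which is what the other IASB variants use
   for the users outside their reference set. For CADSB, convexity of -log rec_m - \<alpha>_m log int_m
   plays the same role; SCALE applies the same bound to user n too. All these inequalities reduce to
   log u \<le> u - 1. *)

theory Submission
  imports Defs
begin

section \<open>Two scalar inequalities for the logarithm\<close>

text \<open>Gibbs' inequality for the two-point distributions \<open>(r0/(1+r0), 1/(1+r0))\<close>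
  and \<open>(r/(1+r), 1/(1+r))\<close>. Equivalently, \<open>ln (1 + r)\<close> is convex in
  \<open>ln r\<close> and lies above its tangent at \<open>ln r0\<close>.\<close>

lemma ln_one_plus_ge_tangent:
  fixes r r0 :: real
  assumes "0 < r" "0 < r0"
  shows "r0 / (1 + r0) * ln r + (ln (1 + r0) - r0 / (1 + r0) * ln r0) \<le> ln (1 + r)"
proof -
  define a where "a = r0 / (1 + r0)"
  \<comment> \<open>The likelihood ratios of the two distributions, so that
    \<open>a * u + (1 - a) * v = 1\<close>.\<close>
  define u where "u = r * (1 + r0) / (r0 * (1 + r))"
  define v where "v = (1 + r0) / (1 + r)"
  have a: "0 \<le> a" "0 \<le> 1 - a"
    using assms by (auto simp: a_def field_simps)
  have "0 < u" "0 < v"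
    using assms by (auto simp: u_def v_def)
  then have "a * ln u + (1 - a) * ln v \<le> a * (u - 1) + (1 - a) * (v - 1)"
    using a by (intro add_mono mult_left_mono ln_le_minus_one) auto
  also have "\<dots> = 0"
  proof -
    have "1 - a = 1 / (1 + r0)"
      using assms by (simp add: a_def field_simps)
    moreover have "a * u = r / (1 + r)"
      using assms by (simp add: a_def u_def)
    moreover have "1 / (1 + r0) * v = 1 / (1 + r)"
      using assms by (simp add: v_def)
    moreover have "r / (1 + r) + 1 / (1 + r) = 1"
      using assms by (simp add: add_divide_distrib[symmetric])
    ultimately have "a * u + (1 - a) * v = 1"
      by simp
    then show ?thesis by (simp add: algebra_simps)
  qed
  finally have le: "a * ln u + (1 - a) * ln v \<le> 0" .
  have "ln u = ln r + ln (1 + r0) - ln r0 - ln (1 + r)" "ln v = ln (1 + r0) - ln (1 + r)"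
    using assms by (simp_all add: u_def v_def ln_mult ln_div)
  with le show ?thesis
    unfolding a_def[symmetric] by (simp add: algebra_simps)
qed

lemma ln_le_tangent:
  fixes x y :: real
  assumes "0 < x" "0 < y"
  shows "ln x \<le> ln y + (x - y) / y"
  using ln_le_minus_one[of "x / y"] assms by (simp add: ln_div diff_divide_distrib)

section \<open>One tone with user \<open>n\<close>'s power varying: signs and interference\<close>

locale tone =
  fixes P :: "'k dsm" and k :: 'k and n :: nat and st :: "nat \<Rightarrow> real"
  assumes valid: "valid_dsm P"
    and user: "n \<in> users P"
    and point: "st \<in> powers P k"
begin

abbreviation others :: "nat set" where
  "others \<equiv> users P - {n}"

abbreviation itf :: "nat \<Rightarrow> real \<Rightarrow> real" where
  "itf m x \<equiv> interf P k (st(n := x)) m"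

definition cost :: "nat \<Rightarrow> real \<Rightarrow> real" where
  "cost m x = - weight P m * ln (1 + (st(n := x)) m / itf m x)"

text \<open>For \<open>m \<noteq> n\<close>, the common derivative at \<open>st n\<close> of
  \<open>cost m\<close> and of its logarithmic upper bound.\<close>

definition slope :: "nat \<Rightarrow> real" where
  "slope m = weight P m * alpha P k st m * gain P k m n / interf P k st m"

lemma finite_users: "finite (users P)"
  by (simp add: users_def)

lemma weight_nonneg: "m \<in> users P \<Longrightarrow> 0 \<le> weight P m"
  and gain_nonneg: "m \<in> users P \<Longrightarrow> l \<in> users P \<Longrightarrow> 0 \<le> gain P k m l"
  and noise_pos: "m \<in> users P \<Longrightarrow> 0 < noise P k m"
  using valid by (auto simp: valid_dsm_def)

lemma point_nonneg: "m \<in> users P \<Longrightarrow> 0 \<le> st m"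
  using point by (force simp: powers_def user_powers_def)

lemma itf_pos:
  assumes "m \<in> users P" "0 \<le> x"
  shows "0 < itf m x"
  unfolding interf_def using assms
  by (intro add_nonneg_pos sum_nonneg mult_nonneg_nonneg gain_nonneg noise_pos)
     (auto intro: point_nonneg)

lemma interf_point_pos: "m \<in> users P \<Longrightarrow> 0 < interf P k st m"
  using itf_pos[of m "st n"] point_nonneg[OF user] by simp

lemma itf_self: "itf n x = interf P k st n"
  unfolding interf_def by (auto intro: sum.cong)

lemma itf_affine:
  assumes "m \<in> others"
  shows "itf m x = interf P k st m + gain P k m n * (x - st n)"
proof -
  have split: "(\<Sum>l\<in>users P - {m}. gain P k m l * s l)
      = gain P k m n * s n + (\<Sum>l\<in>users P - {m} - {n}. gain P k m l * s l)" for s :: "nat \<Rightarrow> real"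
    using user assms finite_users by (intro sum.remove) auto
  show ?thesis
    unfolding interf_def split by (simp add: algebra_simps)
qed

lemma alpha_nonneg: "m \<in> users P \<Longrightarrow> 0 \<le> alpha P k st m"
  using interf_point_pos[of m] point_nonneg[of m] by (simp add: alpha_def recv_def)

text \<open>Brings \<open>alpha\<close> into the form \<open>r0 / (1 + r0)\<close> of
  \<open>ln_one_plus_ge_tangent\<close>, with \<open>r0\<close> the signal-to-interference ratio at
  \<open>st\<close>.\<close>

lemma alpha_eq_sinr:
  assumes "m \<in> users P"
  shows "alpha P k st m
    = (st m / interf P k st m) / (1 + st m / interf P k st m)"
  using interf_point_pos[OF assms] point_nonneg[OF assms]
  by (simp add: alpha_def recv_def field_simps)

lemma obj_eq_sum_cost: "obj P k (st(n := x)) = (\<Sum>m\<in>users P. cost m x)"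
  by (simp add: obj_def cost_def sum_negf)

lemma sum_users_split: "(\<Sum>m\<in>users P. F m) = F n + (\<Sum>m\<in>others. F m)"
  for F :: "nat \<Rightarrow> 'a::comm_monoid_add"
  by (rule sum.remove[OF finite_users user])

section \<open>The logarithmic bound of a cost term and its tangent\<close>

text \<open>For \<open>st m > 0\<close> this is \<open>ln_one_plus_ge_tangent\<close> scaled by the
  weight. Hypothesis \<open>pos\<close> excludes zero power with nonzero \<open>alpha\<close>, where
  \<open>ln\<close> would only have a default value.\<close>

lemma cost_le_neg_log_term:
  assumes m: "m \<in> users P" and x: "0 \<le> x"
    and pos: "alpha P k st m = 0 \<or> 0 < (st(n := x)) m"
  shows "cost m x \<le> - log_term P k st m (st(n := x))"
proof (cases "st m = 0")
  case True
  \<comment> \<open>Here \<open>alpha\<close> and \<open>cconst\<close> vanish, so the right side is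
    0 and the cost need only be nonpositive.\<close>
  have "0 \<le> (st(n := x)) m / itf m x"
    using itf_pos[OF m x] x point_nonneg[OF m] by auto
  then have "0 \<le> ln (1 + (st(n := x)) m / itf m x)"
    by simp
  with True show ?thesis
    using weight_nonneg[OF m] by (simp add: cost_def log_term_def cconst_def alpha_def)
next
  case False
  then have "0 < st m" using point_nonneg[OF m] by simp
  moreover have "0 < (st(n := x)) m"
    using pos \<open>0 < st m\<close> interf_point_pos[OF m] by (auto simp: alpha_def recv_def)
  ultimately show ?thesis
    using mult_left_mono[OF ln_one_plus_ge_tangent weight_nonneg[OF m],
        of "(st(n := x)) m / itf m x" "st m / interf P k st m"]
      itf_pos[OF m x] interf_point_pos[OF m]
    by (simp add: cost_def log_term_def cconst_def alpha_eq_sinr[OF m] algebra_simps)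
qed

text \<open>User \<open>m\<close> keeps the power \<open>st m\<close>, which is positive or makes
  \<open>alpha\<close> zero.\<close>

lemma cost_le_neg_log_term_other:
  assumes "m \<in> others" "0 \<le> x"
  shows "cost m x \<le> - log_term P k st m (st(n := x))"
proof (rule cost_le_neg_log_term)
  show "alpha P k st m = 0 \<or> 0 < (st(n := x)) m"
    using assms point_nonneg[of m] by (cases "st m = 0") (auto simp: alpha_def)
qed (use assms in auto)

text \<open>The constant \<open>cconst\<close> is chosen to make the bound exact at the
  approximation point.\<close>

lemma cost_point: "cost m (st n) = - log_term P k st m st"
  by (simp add: cost_def log_term_def cconst_def algebra_simps)

text \<open>Only \<open>ln (itf m x)\<close> varies with \<open>x\<close> in the bound, with the
  nonnegative coefficient \<open>weight P m * alpha P k st m\<close>, so a bound \<open>b\<close> on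
  its growth carries over.\<close>

lemma neg_log_term_le:
  assumes m: "m \<in> others" and x: "0 \<le> x"
    and L: "ln (itf m x) \<le> ln (interf P k st m) + b"
  shows "- log_term P k st m (st(n := x)) \<le> cost m (st n) + weight P m * alpha P k st m * b"
proof (cases "st m = 0")
  case True
  then show ?thesis
    using m by (simp add: cost_def log_term_def cconst_def alpha_def)
next
  case False
  then have "0 < st m" using point_nonneg[of m] m by auto
  have "0 \<le> weight P m * alpha P k st m"
    using weight_nonneg alpha_nonneg m by simp
  from mult_left_mono[OF L this] show ?thesis
    using \<open>0 < st m\<close> m itf_pos[of m x] interf_point_pos[of m] x unfolding cost_point
    by (simp add: log_term_def ln_div algebra_simps)
qed

lemma neg_log_term_le_tangent:
  assumes m: "m \<in> others" and x: "0 \<le> x"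
  shows "- log_term P k st m (st(n := x)) \<le> cost m (st n) + slope m * (x - st n)"
  using neg_log_term_le[OF m x ln_le_tangent] itf_pos[of m x] interf_point_pos[of m] m x
  by (simp add: itf_affine slope_def mult.assoc)

text \<open>The chain rule gives \<open>w * g * s / (i * (i + s))\<close>, where
  \<open>s / (i + s)\<close> is \<open>alpha\<close>.\<close>

lemma cost_has_derivative:
  assumes m: "m \<in> others"
  shows "(cost m has_real_derivative slope m) (at (st n))"
proof -
  let ?i = "interf P k st m" and ?g = "gain P k m n"
  have i: "0 < ?i" and s: "0 \<le> st m"
    using m interf_point_pos point_nonneg by auto
  have eq: "cost m = (\<lambda>y. - weight P m * ln (1 + st m / (?i + ?g * (y - st n))))"
    using m by (auto simp: cost_def itf_affine)
  show ?thesis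
    unfolding eq slope_def alpha_def recv_def using i s
    by (auto intro!: derivative_eq_intros simp: add_pos_nonneg) (simp add: divide_simps add_eq_0_iff)
qed

text \<open>Opposite to the derivative of \<open>cost m\<close>, so the sum of the two is stationary
  at \<open>st n\<close>; by \<open>cost_point\<close> it also vanishes there.\<close>

lemma log_term_has_derivative:
  assumes m: "m \<in> others"
  shows "((\<lambda>y. log_term P k st m (st(n := y))) has_real_derivative - slope m) (at (st n))"
proof -
  let ?i = "interf P k st m" and ?g = "gain P k m n"
  have i: "0 < ?i"
    using m interf_point_pos by auto
  have eq: "(\<lambda>y. log_term P k st m (st(n := y)))
    = (\<lambda>y. weight P m * alpha P k st m * ln (st m / (?i + ?g * (y - st n))) + cconst P k st m)"
    using m by (auto simp: log_term_def itf_affine)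
  show ?thesis
  proof (cases "st m = 0")
    case True
    then show ?thesis unfolding eq slope_def by (simp add: alpha_def)
  next
    case False
    then have "0 < st m" using point_nonneg[of m] m by auto
    then show ?thesis
      unfolding eq slope_def using i
      by (auto intro!: derivative_eq_intros simp: field_simps)
  qed
qed

section \<open>Closed forms of the IASB approximations and their comparison\<close>

lemma IASB_f1_eq:
  assumes "R \<subseteq> others"
  shows "IASB_f1 P k n st R (st(n := x)) = cost n x - (\<Sum>p\<in>R. log_term P k st p (st(n := x)))"
  by (simp add: IASB_f1_def cost_def)

lemma approx_of_eqI:
  assumes "((\<lambda>y. obj P k (st(n := y)) - f1 (st(n := y))) has_real_derivative D) (at (st n))"
  shows "approx_of P k n st f1 x = f1 (st(n := x)) + (obj P k st - f1 st) + D * (x - st n)"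
  by (simp add: approx_of_def LIN_def DERIV_imp_deriv[OF assms])

text \<open>A reference user's share of the linearized part is zero to first order at
  \<open>st n\<close>, so tangents remain only for users outside \<open>R\<close>.\<close>

lemma approx_of_IASB:
  assumes R: "R \<subseteq> others"
  shows "approx_of P k n st (IASB_f1 P k n st R) x
    = cost n x + (\<Sum>p\<in>R. - log_term P k st p (st(n := x)))
      + (\<Sum>m\<in>others - R. cost m (st n) + slope m * (x - st n))"
proof -
  have diff: "obj P k (st(n := y)) - IASB_f1 P k n st R (st(n := y))
      = (\<Sum>m\<in>others. cost m y) + (\<Sum>p\<in>R. log_term P k st p (st(n := y)))" for y
    using R by (simp add: obj_eq_sum_cost IASB_f1_eq sum_users_split)
  have split: "(\<Sum>m\<in>others. F m) = (\<Sum>m\<in>others - R. F m) + (\<Sum>m\<in>R. F m)" for F :: "nat \<Rightarrow> real"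
    using R finite_users by (intro sum.subset_diff) auto
  have "((\<lambda>y. (\<Sum>m\<in>others. cost m y) + (\<Sum>p\<in>R. log_term P k st p (st(n := y))))
      has_real_derivative (\<Sum>m\<in>others. slope m) + (\<Sum>p\<in>R. - slope p)) (at (st n))"
    using R by (intro derivative_intros cost_has_derivative log_term_has_derivative) auto
  \<comment> \<open>The slopes over \<open>R\<close> cancel.\<close>
  then have der: "((\<lambda>y. obj P k (st(n := y)) - IASB_f1 P k n st R (st(n := y)))
      has_real_derivative (\<Sum>m\<in>others - R. slope m)) (at (st n))"
    unfolding diff split by (simp add: sum_negf)
  have "obj P k st - IASB_f1 P k n st R st = (\<Sum>m\<in>others - R. cost m (st n))"
    using diff[of "st n"] unfolding split by (simp add: cost_point sum_negf)
  then show ?thesis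
    unfolding approx_of_eqI[OF der] IASB_f1_eq[OF R]
    by (simp add: sum.distrib sum_negf sum_distrib_right)
qed

text \<open>With all other users in the reference set, no tangent is left.\<close>

lemma f_IASB10_eq:
  "f_IASB10 P k n st x = cost n x + (\<Sum>m\<in>others. - log_term P k st m (st(n := x)))"
  unfolding f_IASB10_def by (simp add: approx_of_IASB)

lemma obj_le_f_IASB10:
  assumes "0 \<le> x"
  shows "obj P k (st(n := x)) \<le> f_IASB10 P k n st x"
  unfolding f_IASB10_eq obj_eq_sum_cost sum_users_split
  using assms by (intro add_left_mono sum_mono cost_le_neg_log_term_other) auto

text \<open>The two sides differ only on \<open>others - R\<close>, where the concave bound meets
  its tangent. The sets \<open>{}\<close>, \<open>{q}\<close> and \<open>{q, t}\<close> give IASB1,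
  IASB4 and IASB5.\<close>

lemma f_IASB10_le_IASB:
  assumes R: "R \<subseteq> others" and x: "0 \<le> x"
  shows "f_IASB10 P k n st x \<le> approx_of P k n st (IASB_f1 P k n st R) x"
proof -
  have "(\<Sum>m\<in>others. - log_term P k st m (st(n := x)))
      = (\<Sum>m\<in>others - R. - log_term P k st m (st(n := x))) + (\<Sum>m\<in>R. - log_term P k st m (st(n := x)))"
    using R finite_users by (intro sum.subset_diff) auto
  also have "\<dots> \<le> (\<Sum>m\<in>others - R. cost m (st n) + slope m * (x - st n))
      + (\<Sum>m\<in>R. - log_term P k st m (st(n := x)))"
    using x by (intro add_right_mono sum_mono neg_log_term_le_tangent) auto
  finally show ?thesis
    unfolding f_IASB10_eq approx_of_IASB[OF R] by simp
qed

section \<open>Comparison with CADSB\<close>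

text \<open>Separates the part that CADSB keeps, in the received power, from the part it linearizes,
  in the interference.\<close>

lemma cost_eq_ln_diff:
  assumes "m \<in> users P" "0 \<le> x"
  shows "cost m x = weight P m * ln (itf m x) - weight P m * ln (recv P k (st(n := x)) m)"
proof -
  have "0 \<le> (st(n := x)) m"
    using assms point_nonneg[OF assms(1)] by simp
  then have "0 < recv P k (st(n := x)) m"
    using itf_pos[OF assms] unfolding recv_def by linarith
  moreover have "1 + (st(n := x)) m / itf m x = recv P k (st(n := x)) m / itf m x"
    using itf_pos[OF assms] by (simp add: recv_def add_divide_distrib)
  ultimately show ?thesis
    using itf_pos[OF assms] by (simp add: cost_def ln_div right_diff_distrib del: fun_upd_apply)
qed

text \<open>Since received power is signal plus interference, \<open>alpha\<close> and
  \<open>interf / recv\<close> sum to 1. The right side is the derivative of the weighted log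
  interference.\<close>

lemma slope_add_ln_recv_slope:
  assumes m: "m \<in> others"
  shows "slope m + weight P m * (gain P k m n / recv P k st m)
    = weight P m * gain P k m n / interf P k st m"
proof -
  have "0 < interf P k st m" "0 < recv P k st m"
    using m interf_point_pos[of m] point_nonneg[of m] by (auto simp: recv_def)
  moreover from this have "alpha P k st m + interf P k st m / recv P k st m = 1"
    by (simp add: alpha_def recv_def add_divide_distrib[symmetric])
  moreover have "slope m + weight P m * (gain P k m n / recv P k st m)
      = weight P m * gain P k m n / interf P k st m
        * (alpha P k st m + interf P k st m / recv P k st m)"
    using \<open>0 < interf P k st m\<close> by (simp add: slope_def distrib_left)
  ultimately show ?thesis
    by simp
qed

lemma ln_recv_has_derivative:
  assumes m: "m \<in> others"
  shows "((\<lambda>y. ln (recv P k (st(n := y)) m)) has_real_derivative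
      gain P k m n / recv P k st m) (at (st n))"
proof -
  have "0 < recv P k st m"
    using m interf_point_pos[of m] point_nonneg[of m] by (simp add: recv_def)
  then show ?thesis
    using m unfolding recv_def
    by (auto simp: itf_affine intro!: derivative_eq_intros)
qed

lemma approx_of_CADSB:
  "approx_of P k n st (CADSB_f1 P k) x
    = CADSB_f1 P k (st(n := x)) + (\<Sum>m\<in>users P. weight P m * ln (interf P k st m))
      + (\<Sum>m\<in>others. weight P m * gain P k m n / interf P k st m) * (x - st n)"
proof -
  have diff: "obj P k (st(n := y)) - CADSB_f1 P k (st(n := y))
      = (\<Sum>m\<in>users P. cost m y + weight P m * ln (recv P k (st(n := y)) m))" for y
    by (simp add: obj_eq_sum_cost CADSB_f1_def sum.distrib)
  \<comment> \<open>Near \<open>st n\<close> this is the weighted log interference of user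
    \<open>n\<close>, which does not depend on \<open>y\<close>.\<close>
  have "((\<lambda>y. cost n y + weight P n * ln (recv P k (st(n := y)) n)) has_real_derivative 0)
      (at (st n))"
  proof -
    have "0 < st n + interf P k st n"
      using interf_point_pos[OF user] point_nonneg[OF user] by simp
    moreover have "1 + st n / interf P k st n = (st n + interf P k st n) / interf P k st n"
      using interf_point_pos[OF user] by (simp add: add_divide_distrib)
    ultimately show ?thesis
      using interf_point_pos[OF user] unfolding cost_def recv_def itf_self
      by (auto intro!: derivative_eq_intros)
  qed
  moreover have "((\<lambda>y. cost m y + weight P m * ln (recv P k (st(n := y)) m)) has_real_derivative
      weight P m * gain P k m n / interf P k st m) (at (st n))" if m: "m \<in> others" for m
    using DERIV_add[OF cost_has_derivative[OF m] DERIV_cmult[OF ln_recv_has_derivative[OF m], of "weight P m"]]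
    by (simp only: slope_add_ln_recv_slope[OF m])
  ultimately have "((\<lambda>y. (cost n y + weight P n * ln (recv P k (st(n := y)) n))
        + (\<Sum>m\<in>others. cost m y + weight P m * ln (recv P k (st(n := y)) m)))
      has_real_derivative 0 + (\<Sum>m\<in>others. weight P m * gain P k m n / interf P k st m)) (at (st n))"
    by (intro DERIV_add DERIV_sum) auto
  then have "((\<lambda>y. obj P k (st(n := y)) - CADSB_f1 P k (st(n := y)))
      has_real_derivative (\<Sum>m\<in>others. weight P m * gain P k m n / interf P k st m)) (at (st n))"
    unfolding diff sum_users_split by simp
  moreover have "obj P k st - CADSB_f1 P k st = (\<Sum>m\<in>users P. weight P m * ln (interf P k st m))"
    using diff[of "st n"] cost_eq_ln_diff[of _ "st n"] point_nonneg[OF user] by simp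
  ultimately show ?thesis
    by (simp add: approx_of_eqI)
qed

text \<open>Adds two tangent bounds of \<open>ln\<close>, one for the interference and one for the
  received power; \<open>slope_add_ln_recv_slope\<close> merges their slopes into the CADSB
  slope.\<close>

lemma neg_log_term_le_CADSB_term:
  assumes m: "m \<in> others" and x: "0 \<le> x"
  shows "- log_term P k st m (st(n := x))
    \<le> - weight P m * ln (recv P k (st(n := x)) m) + weight P m * ln (interf P k st m)
      + weight P m * gain P k m n / interf P k st m * (x - st n)"
proof -
  let ?i = "interf P k st m" and ?r = "recv P k st m"
  let ?d = "gain P k m n * (x - st n)"
  have r: "0 < ?r" and rx: "0 < recv P k (st(n := x)) m"
    using m x interf_point_pos[of m] point_nonneg[of m] itf_pos[of m x] by (auto simp: recv_def)
  have rd: "recv P k (st(n := x)) m = ?r + ?d"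
    using m by (simp add: recv_def itf_affine)
  have "ln (recv P k (st(n := x)) m) \<le> ln ?r + ?d / ?r"
    using ln_le_tangent[OF rx r] by (simp add: rd)
  then have "weight P m * ln (recv P k (st(n := x)) m) \<le> weight P m * (ln ?r + ?d / ?r)"
    using m weight_nonneg by (intro mult_left_mono) auto
  moreover have "- log_term P k st m (st(n := x)) \<le> cost m (st n) + slope m * (x - st n)"
    by (rule neg_log_term_le_tangent[OF m x])
  moreover have "cost m (st n) = weight P m * ln ?i - weight P m * ln ?r"
    using cost_eq_ln_diff[of m "st n"] m point_nonneg[OF user] by simp
  moreover have "slope m * (x - st n) + weight P m * (?d / ?r)
      = weight P m * gain P k m n / ?i * (x - st n)"
    unfolding slope_add_ln_recv_slope[OF m, symmetric] by (simp add: algebra_simps)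
  ultimately show ?thesis
    by (simp add: algebra_simps)
qed

lemma f_IASB10_le_CADSB:
  assumes x: "0 \<le> x"
  shows "f_IASB10 P k n st x \<le> f_CADSB P k n st x"
proof -
  have "(\<Sum>m\<in>others. - log_term P k st m (st(n := x)))
    \<le> (\<Sum>m\<in>others. - weight P m * ln (recv P k (st(n := x)) m) + weight P m * ln (interf P k st m)
      + weight P m * gain P k m n / interf P k st m * (x - st n))"
    using x by (intro sum_mono neg_log_term_le_CADSB_term)
  \<comment> \<open>Both approximations are exact in user \<open>n\<close>'s own term, as its
    interference is constant.\<close>
  moreover have "cost n x = weight P n * ln (interf P k st n) - weight P n * ln (recv P k (st(n := x)) n)"
    using cost_eq_ln_diff[OF user x] by (simp add: itf_self)
  ultimately show ?thesis
    unfolding f_IASB10_eq f_CADSB_def approx_of_CADSB CADSB_f1_def sum_users_split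
    by (simp add: sum.distrib sum_negf sum_distrib_right sum_subtractf)
qed

section \<open>Comparison with SCALE\<close>

text \<open>Both sides share the terms of the other users; SCALE replaces the exact cost of user
  \<open>n\<close> by its bound, possibly infinite.\<close>

lemma f_IASB10_le_SCALE:
  assumes x: "0 \<le> x"
  shows "ereal (f_IASB10 P k n st x) \<le> f_SCALE P k n st x"
proof -
  have "(\<Sum>m\<in>others. neg_log_term P k st m (st(n := x)))
      = (\<Sum>m\<in>others. ereal (- log_term P k st m (st(n := x))))"
    by (intro sum.cong) (simp_all add: neg_log_term_other_user)
  then have S: "f_SCALE P k n st x = neg_log_term P k st n (st(n := x))
      + ereal (\<Sum>m\<in>others. - log_term P k st m (st(n := x)))"
    by (simp only: f_SCALE_def sum_users_split sum_ereal)
  have "ereal (cost n x) \<le> neg_log_term P k st n (st(n := x))"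
  proof (cases "weight P n = 0")
    \<comment> \<open>At zero weight both sides are 0, even at \<open>x = 0\<close> with
      \<open>alpha\<close> positive, where \<open>pos\<close> would fail.\<close>
    case True
    then show ?thesis
      by (simp add: neg_log_term_def cost_def log_term_def cconst_def)
  next
    case False
    then have "0 < weight P n"
      using weight_nonneg[OF user] by simp
    \<comment> \<open>For positive weight, \<open>pos\<close> fails exactly where
      \<open>neg_log_term\<close> is infinite.\<close>
    then show ?thesis
      using cost_le_neg_log_term[OF user x] x alpha_nonneg[OF user]
      by (cases "alpha P k st n = 0") (auto simp: neg_log_term_def)
  qed
  then show ?thesis
    unfolding S f_IASB10_eq plus_ereal.simps(1)[symmetric] by (rule add_right_mono)
qed

section \<open>Assembly of the five comparisons\<close>

lemma tighter_IASB10I: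
  assumes "\<And>x. 0 \<le> x \<Longrightarrow> ereal (f_IASB10 P k n st x) \<le> B x"
  shows "tighter P k n st (\<lambda>x. ereal (f_IASB10 P k n st x)) B"
  using assms obj_le_f_IASB10 by (auto simp: tighter_def user_powers_def)

end

theorem mainTheorem8:
  fixes P :: "'k dsm"
  assumes "valid_dsm P"
    and "num_users P \<ge> 3"
  shows "\<forall>k. \<forall>n\<in>users P. \<forall>q\<in>users P - {n}. \<forall>t\<in>users P - {n}. \<forall>st\<in>powers P k. q \<noteq> t \<longrightarrow>
    tighter P k n st (\<lambda>x. ereal (f_IASB10 P k n st x)) (\<lambda>x. ereal (f_IASB1 P k n st x)) \<and>
    tighter P k n st (\<lambda>x. ereal (f_IASB10 P k n st x)) (\<lambda>x. ereal (f_IASB4 P k n q st x)) \<and>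
    tighter P k n st (\<lambda>x. ereal (f_IASB10 P k n st x)) (\<lambda>x. ereal (f_IASB5 P k n q t st x)) \<and>
    tighter P k n st (\<lambda>x. ereal (f_IASB10 P k n st x)) (\<lambda>x. ereal (f_CADSB P k n st x)) \<and>
    tighter P k n st (\<lambda>x. ereal (f_IASB10 P k n st x)) (f_SCALE P k n st)"
proof (intro allI ballI impI)
  fix k n q t and st :: "nat \<Rightarrow> real"
  assume n: "n \<in> users P" and q: "q \<in> users P - {n}" and t: "t \<in> users P - {n}"
    and st: "st \<in> powers P k"
  interpret tone P k n st
    using assms(1) n st by unfold_locales
  show "tighter P k n st (\<lambda>x. ereal (f_IASB10 P k n st x)) (\<lambda>x. ereal (f_IASB1 P k n st x)) \<and>
    tighter P k n st (\<lambda>x. ereal (f_IASB10 P k n st x)) (\<lambda>x. ereal (f_IASB4 P k n q st x)) \<and>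
    tighter P k n st (\<lambda>x. ereal (f_IASB10 P k n st x)) (\<lambda>x. ereal (f_IASB5 P k n q t st x)) \<and>
    tighter P k n st (\<lambda>x. ereal (f_IASB10 P k n st x)) (\<lambda>x. ereal (f_CADSB P k n st x)) \<and>
    tighter P k n st (\<lambda>x. ereal (f_IASB10 P k n st x)) (f_SCALE P k n st)"
    unfolding f_IASB1_def f_IASB4_def f_IASB5_def using q t
    by (intro conjI tighter_IASB10I)
       (auto intro: f_IASB10_le_IASB f_IASB10_le_CADSB f_IASB10_le_SCALE)
qed

end
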